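(* Let $G$ be a connected graph of order $n$ and diameter $D$. Then $$\dim_2(G)\leq n-D-1+\left\lfloor\frac{2D+4}{5}\right\rfloor .$$
   Context: All graphs are finite and simple; the order of a graph is its number of vertices, and the diameter is the maximum distance between two vertices. For a graph $G$ and vertices $x,y\in V(G)$, put $a_G(x,y)=0$ if $x=y$, $a_G(x,y)=1$ if $x$ and $y$ are adjacent, and $a_G(x,y)=2$ otherwise. For a set $W=\{w_1,\ldots,w_k\}\subseteq V(G)$ and a vertex $v\in V(G)$, the adjacency representation of $v$ with respect to $W$ is the $k$-vector $r_2(v|W)=(a_G(v,w_1),\ldots,a_G(v,w_k))$. The set $W$ is an adjacency resolving set for $G$ if the vectors $r_2(v|W)$, $v\in V(G)$, are pairwise distinct. The adjacency dimension $\dim_2(G)$ is the minimum cardinality of an adjacency resolving set for $G$. *)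

theory Defs
  imports "Graph_Theory.Graph_Theory" "HOL-Library.FuncSet"
begin

text \<open>
  Finite simple graphs are the locale \<open>graph\<close> of the AFP entry \<open>Graph_Theory\<close> (finite, loop-free,
  symmetric digraphs without parallel arcs, so that an edge is a pair of opposite arcs);
  the library's \<open>connected\<close> includes nonemptiness of the vertex set.
\<close>

text \<open>Unspecified when there is no walk from \<open>u\<close> to \<open>v\<close>; only used for connected graphs.\<close>

definition graph_dist :: "('a, 'b) pre_digraph \<Rightarrow> 'a \<Rightarrow> 'a \<Rightarrow> nat" where
  "graph_dist G u v = (LEAST k. \<exists>p. pre_digraph.awalk G u p v \<and> length p = k)"

definition graph_diameter :: "('a, 'b) pre_digraph \<Rightarrow> nat" where
  "graph_diameter G = Max {graph_dist G u v | u v. u \<in> verts G \<and> v \<in> verts G}"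

definition adj_dist :: "('a, 'b) pre_digraph \<Rightarrow> 'a \<Rightarrow> 'a \<Rightarrow> nat" where
  "adj_dist G x y = (if x = y then 0 else if x \<rightarrow>\<^bsub>G\<^esub> y then 1 else 2)"

text \<open>
  The vector \<open>r\<^sub>2(v|W)\<close>, with its coordinates indexed by the elements of \<open>W\<close> themselves instead
  of by an enumeration of \<open>W\<close>. The bounded abstraction makes it depend on the values on \<open>W\<close> only.
\<close>

definition adj_rep :: "('a, 'b) pre_digraph \<Rightarrow> 'a set \<Rightarrow> 'a \<Rightarrow> 'a \<Rightarrow> nat" where
  "adj_rep G W v = (\<lambda>w\<in>W. adj_dist G v w)"

definition adj_resolving :: "('a, 'b) pre_digraph \<Rightarrow> 'a set \<Rightarrow> bool" where
  "adj_resolving G W \<longleftrightarrow> W \<subseteq> verts G \<and> inj_on (adj_rep G W) (verts G)"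

definition adj_dim :: "('a, 'b) pre_digraph \<Rightarrow> nat" where
  "adj_dim G = (LEAST k. \<exists>W. adj_resolving G W \<and> card W = k)"

text \<open>\<open>graph_dist\<close> is the library's weighted distance for unit weights.\<close>

lemma (in wf_digraph) graph_dist_eq_\<mu>:
  assumes "u \<rightarrow>\<^sup>* v"
  shows "ereal (real (graph_dist G u v)) = \<mu> (\<lambda>_. 1) u v"
proof -
  have cost: "awalk_cost (\<lambda>_. 1) p = real (length p)" for p :: "'b list"
    by (induction p) auto
  from assms obtain p where "awalk u p v"
    by (auto simp: reachable_awalk)
  then have "\<exists>k. \<exists>p. awalk u p v \<and> length p = k" by blast
  then have "\<exists>p. awalk u p v \<and> length p = graph_dist G u v"
    unfolding graph_dist_def by (rule LeastI_ex)
  then obtain q where q: "awalk u q v" "length q = graph_dist G u v" by blast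
  have le: "graph_dist G u v \<le> length p" if "awalk u p v" for p
    unfolding graph_dist_def by (rule Least_le) (use that in blast)
  have "\<mu> (\<lambda>_. 1) u v \<le> ereal (real (graph_dist G u v))"
    using min_cost_le_walk_cost[OF q(1), of "\<lambda>_. 1"] q(2) by (simp add: cost)
  moreover have "ereal (real (graph_dist G u v)) \<le> \<mu> (\<lambda>_. 1) u v"
    unfolding \<mu>_def by (rule INF_greatest) (use le in \<open>auto simp: cost\<close>)
  ultimately show ?thesis by simp
qed

text \<open>The minimum defining \<open>adj_dim\<close> ranges over a nonempty set.\<close>

lemma adj_resolving_verts: "adj_resolving G (verts G)"
  unfolding adj_resolving_def
proof (intro conjI inj_onI)
  fix x y assume xy: "x \<in> verts G" "y \<in> verts G" "adj_rep G (verts G) x = adj_rep G (verts G) y"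
  from fun_cong[OF xy(3), of y] xy(2) have "adj_dist G x y = 0"
    by (simp add: adj_rep_def adj_dist_def)
  then show "x = y"
    by (simp add: adj_dist_def split: if_splits)
qed simp

end

theory Submission
  imports Defs
begin

text \<open>
  Keep every vertex outside a diametral path, so that only the path vertices have to be told apart.
  The path is induced, hence this is the problem of resolving a path on \<open>m = D + 1\<close> vertices. There
  take the residues 1 and 3 modulo 5: in a block \<open>0,\<dots>,4\<close> the other vertices see \<open>{1}\<close>,
  \<open>{1,3}\<close> and \<open>{3}\<close>. Truncating the pattern fails only for \<open>m \<equiv> 3\<close> modulo 5, where the last vertex
  would see the same as the last but two; there the pattern is shifted by 3.
\<close>

definition path_resolving :: "nat \<Rightarrow> nat set" where
  "path_resolving m = {i. i < m \<and> (i + (if m mod 5 = 3 then 3 else 0)) mod 5 \<in> {1, 3}}"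

text \<open>\<open>(2 * t + 2) div 5\<close> counts the numbers below \<open>t\<close> with residue
  1 or 3 modulo 5. The count here is the difference of these values at \<open>t = m + s\<close> and
  \<open>t = s\<close>, multiplied by 5 and arranged so that no subtraction of naturals
  occurs.\<close>

lemma card_residues_1_3:
  "5 * card {i::nat. i < m \<and> (i + s) mod 5 \<in> {1, 3}} + (2 * (m + s) + 2) mod 5 =
    2 * m + (2 * s + 2) mod 5"
proof (induction m)
  case (Suc m)
  have "{i. i < Suc m \<and> (i + s) mod 5 \<in> {1, 3}} =
      (if (m + s) mod 5 \<in> {1, 3} then insert m else id) {i. i < m \<and> (i + s) mod 5 \<in> {1, 3}}"
    by (auto simp: less_Suc_eq)
  then have card_Suc: "card {i. i < Suc m \<and> (i + s) mod 5 \<in> {1, 3}} =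
      (if (m + s) mod 5 \<in> {1, 3} then Suc else id) (card {i. i < m \<and> (i + s) mod 5 \<in> {1, 3}})"
    by auto
  define t where "t = m + s"
  have double: "(2 * x + 2) mod 5 = (2 * (x mod 5) + 2) mod 5" for x :: nat
    by (metis mod_add_left_eq mod_mult_right_eq)
  have "t mod 5 < 5" by simp
  then consider "t mod 5 = 0" | "t mod 5 = 1" | "t mod 5 = 2" | "t mod 5 = 3" | "t mod 5 = 4"
    by linarith
  \<comment> \<open>From \<open>t\<close> to \<open>Suc t\<close> the remainder of
    \<open>2 * t + 2\<close> grows by 2, except at residues 1 and 3, where it drops by 3 and the
    count gains one.\<close>
  then show ?case
    using Suc unfolding card_Suc add_Suc t_def[symmetric] double[of t] double[of "Suc t"]
    by cases (simp_all add: mod_Suc)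
qed simp

text \<open>The shift leaves the cardinality unchanged: for \<open>m mod 5 = 3\<close> both patterns
  give five times the count as \<open>2 * m - 1\<close>.\<close>

lemma card_path_resolving: "card (path_resolving m) = (2 * m + 2) div 5"
proof -
  have "5 * card (path_resolving m) + (2 * m + 2) mod 5 = 2 * m + 2"
  proof (cases "m mod 5 = 3")
    case True
    have "(2 * m + 2) mod 5 = (2 * (m mod 5) + 2) mod 5"
      by (metis mod_add_left_eq mod_mult_right_eq)
    moreover have "(8 + 2 * m) mod 5 = (8 + 2 * (m mod 5)) mod 5"
      by (metis mod_add_right_eq mod_mult_right_eq)
    ultimately show ?thesis
      using card_residues_1_3[of m 3] True by (simp add: path_resolving_def)
  next
    case False
    then show ?thesis
      using card_residues_1_3[of m 0] by (simp add: path_resolving_def)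
  qed
  then show ?thesis
    using mult_div_mod_eq[of 5 "2 * m + 2"] by linarith
qed

text \<open>The separating \<open>k\<close> is a chosen neighbour of \<open>i\<close>. With
  \<open>i < j\<close> a left neighbour of \<open>i\<close> is never next to \<open>j\<close>, so
  only a right neighbour can fail, and only for \<open>j = i + 2\<close>.\<close>

lemma path_resolving_separates:
  assumes "i < j" "j < m" "i \<notin> path_resolving m" "j \<notin> path_resolving m"
  obtains k where "k \<in> path_resolving m" "(Suc i = k \<or> i = Suc k) \<noteq> (Suc j = k \<or> j = Suc k)"
proof -
  define s :: nat where "s = (if m mod 5 = 3 then 3 else 0)"
  have S: "k \<in> path_resolving m \<longleftrightarrow> k < m \<and> ((k + s) mod 5 = 1 \<or> (k + s) mod 5 = 3)" for k
    by (auto simp: path_resolving_def s_def)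
  have s: "s = 3 \<and> m mod 5 = 3 \<or> s = 0 \<and> m mod 5 \<noteq> 3"
    by (simp add: s_def)
  have "(i + s) mod 5 \<noteq> 1" "(i + s) mod 5 \<noteq> 3" "(j + s) mod 5 \<noteq> 1" "(j + s) mod 5 \<noteq> 3"
    using assms by (auto simp: S)
  moreover have "(i + s) mod 5 < 5" by simp
  ultimately consider "(i + s) mod 5 = 0" | "(i + s) mod 5 = 2" | "(i + s) mod 5 = 4"
    by linarith
  then show thesis
  proof cases
    case 1
    then have next_i: "(Suc i + s) mod 5 = 1" by (simp add: mod_Suc)
    then have "j \<noteq> Suc i" using \<open>(j + s) mod 5 \<noteq> 1\<close> by auto
    show thesis
    proof (cases "j = i + 2")
      \<comment> \<open>Here \<open>i + 1\<close> lies next to both, so the right neighbour of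
        \<open>j\<close>, of shifted residue 3, is used instead.\<close>
      case True
      then have "(Suc j + s) mod 5 = 3" using 1 by (simp add: mod_Suc)
      \<comment> \<open>This is the purpose of the shift: \<open>Suc j = m\<close> would give
        \<open>m + s\<close> residue 3, but its residue is 1 if \<open>s = 3\<close> and is
        \<open>m mod 5\<close>, different from 3, if \<open>s = 0\<close>.\<close>
      moreover have "Suc j \<noteq> m"
      proof
        assume "Suc j = m"
        then have "(m mod 5 + s) mod 5 = 3"
          using \<open>(Suc j + s) mod 5 = 3\<close> by (simp add: mod_add_left_eq)
        then show False using s by auto
      qed
      ultimately show thesis
        using that[of "Suc j"] True assms(2) by (simp add: S)
    next
      case False
      then show thesis
        using that[of "Suc i"] next_i assms(1,2) \<open>j \<noteq> Suc i\<close> by (simp add: S)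
    qed
  next
    case 2
    \<comment> \<open>Position 0 has shifted residue 0 or 3, so residues 2 and 4 always have a left
      neighbour.\<close>
    then have "i \<noteq> 0" using s by (cases i) auto
    then have "(i - 1 + s) mod 5 = 1" using 2 by (cases i) (auto simp: mod_Suc split: if_splits)
    then show thesis
      using that[of "i - 1"] \<open>i \<noteq> 0\<close> assms(1,2) by (auto simp: S)
  next
    case 3
    then have "i \<noteq> 0" using s by (cases i) auto
    then have "(i - 1 + s) mod 5 = 3" using 3 by (cases i) (auto simp: mod_Suc split: if_splits)
    then show thesis
      using that[of "i - 1"] \<open>i \<noteq> 0\<close> assms(1,2) by (auto simp: S)
  qed
qed

context wf_digraph
begin

lemma graph_dist_le_length: "awalk u p v \<Longrightarrow> graph_dist G u v \<le> length p"
  unfolding graph_dist_def by (rule Least_le) blast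

lemma shortest_awalk:
  assumes "u \<rightarrow>\<^sup>* v"
  obtains p where "awalk u p v" "length p = graph_dist G u v"
proof -
  have "\<exists>k p. awalk u p v \<and> length p = k"
    using assms by (auto simp: reachable_awalk)
  then have "\<exists>p. awalk u p v \<and> length p = graph_dist G u v"
    unfolding graph_dist_def by (rule LeastI_ex)
  then show thesis using that by blast
qed

lemma graph_dist_arc_le:
  assumes "u \<rightarrow>\<^sup>* v" "v \<rightarrow>\<^bsub>G\<^esub> w"
  shows "graph_dist G u w \<le> Suc (graph_dist G u v)"
proof -
  obtain p where p: "awalk u p v" "length p = graph_dist G u v"
    using shortest_awalk[OF assms(1)] .
  obtain e where e: "e \<in> arcs G" "tail G e = v" "head G e = w"
    using assms(2) by auto
  then have "awalk u (p @ [e]) w"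
    using p(1) arc_implies_awalk[of e] by (metis awalk_appendI)
  from graph_dist_le_length[OF this] show ?thesis
    by (simp add: p(2))
qed

text \<open>Delete the last arc of a shortest walk: the remaining walk bounds the distance of its
  end from above, and \<open>graph_dist_arc_le\<close> bounds it from below.\<close>

lemma graph_dist_predecessor:
  assumes "u \<rightarrow>\<^sup>* v" "graph_dist G u v = Suc k"
  obtains w where "u \<rightarrow>\<^sup>* w" "w \<rightarrow>\<^bsub>G\<^esub> v" "graph_dist G u w = k"
proof -
  obtain p where p: "awalk u p v" "length p = Suc k"
    using shortest_awalk[OF assms(1)] assms(2) by metis
  obtain q e where qe: "p = q @ [e]"
    using p(2) by (cases p rule: rev_cases) auto
  have walk: "awalk u q (tail G e)" and "tail G e \<rightarrow>\<^bsub>G\<^esub> v"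
    using p(1) by (auto simp: qe awalk_Cons_iff awalk_Nil_iff
        intro!: in_arcs_imp_in_arcs_ends)
  moreover have "u \<rightarrow>\<^sup>* tail G e"
    using walk by (auto simp: reachable_awalk)
  ultimately have "graph_dist G u (tail G e) = k"
    using graph_dist_le_length[OF walk] graph_dist_arc_le[of u "tail G e" v] assms(2) p(2) qe
    by simp
  then show thesis
    using that \<open>u \<rightarrow>\<^sup>* tail G e\<close> \<open>tail G e \<rightarrow>\<^bsub>G\<^esub> v\<close> by blast
qed

text \<open>Built backwards from \<open>v\<close> by repeated predecessors. Indexing by the distance
  from \<open>u\<close> later yields injectivity and the absence of chords; reachability is carried
  along because \<open>graph_dist\<close> is meaningful only with it.\<close>

lemma geodesic:
  assumes "u \<rightarrow>\<^sup>* v"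
  obtains f where "\<And>i. i \<le> graph_dist G u v \<Longrightarrow> u \<rightarrow>\<^sup>* f i \<and> graph_dist G u (f i) = i"
    and "\<And>i. i < graph_dist G u v \<Longrightarrow> f i \<rightarrow>\<^bsub>G\<^esub> f (Suc i)"
proof -
  have "\<exists>f. f k = v \<and> (\<forall>i\<le>k. u \<rightarrow>\<^sup>* f i \<and> graph_dist G u (f i) = i) \<and> (\<forall>i<k. f i \<rightarrow>\<^bsub>G\<^esub> f (Suc i))"
    if "u \<rightarrow>\<^sup>* v" "graph_dist G u v = k" for k v
    using that
  proof (induction k arbitrary: v)
    case 0
    then show ?case by (intro exI[of _ "\<lambda>_. v"]) simp
  next
    case (Suc k)
    obtain w where w: "u \<rightarrow>\<^sup>* w" "w \<rightarrow>\<^bsub>G\<^esub> v" "graph_dist G u w = k"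
      using graph_dist_predecessor[OF Suc.prems] .
    obtain f where "f k = w" "\<forall>i\<le>k. u \<rightarrow>\<^sup>* f i \<and> graph_dist G u (f i) = i"
      "\<forall>i<k. f i \<rightarrow>\<^bsub>G\<^esub> f (Suc i)"
      using Suc.IH[OF w(1,3)] by blast
    then show ?case
      using w(2) Suc.prems by (intro exI[of _ "f(Suc k := v)"]) (auto simp: le_Suc_eq less_Suc_eq)
  qed
  then show thesis using assms that by blast
qed

end

lemma adj_dim_le: "adj_resolving G W \<Longrightarrow> adj_dim G \<le> card W"
  unfolding adj_dim_def by (rule Least_le) blast

lemma adj_rep_eqD: "adj_rep G W x = adj_rep G W y \<Longrightarrow> w \<in> W \<Longrightarrow> adj_dist G x w = adj_dist G y w"
  by (drule fun_cong[of _ _ w]) (simp add: adj_rep_def)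

lemma adj_dist_eq_0_iff: "adj_dist G x y = 0 \<longleftrightarrow> x = y"
  by (simp add: adj_dist_def)

theorem lemma2p1:
  fixes G :: "('a, 'b) pre_digraph" and n D :: nat
  assumes "graph G"
    and "Digraph_Component.connected G"
    and "card (verts G) = n"
    and "graph_diameter G = D"
  shows "int (adj_dim G) \<le> int n - int D - 1 + \<lfloor>(2 * real D + 4) / 5\<rfloor>"
proof -
  interpret graph G by fact
  have reach: "x \<rightarrow>\<^sup>*\<^bsub>G\<^esub> y" if "x \<in> verts G" "y \<in> verts G" for x y
    using symmetric_connected_imp_strongly_connected[OF sym_arcs assms(2)] that by auto
  have adj_sym: "y \<rightarrow>\<^bsub>G\<^esub> x" if "x \<rightarrow>\<^bsub>G\<^esub> y" for x y
    using sym_arcs that unfolding symmetric_def by (rule symD)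
  let ?d = "{graph_dist G u v | u v. u \<in> verts G \<and> v \<in> verts G}"
  have "?d = (\<lambda>(u, v). graph_dist G u v) ` (verts G \<times> verts G)" by auto
  moreover have "verts G \<noteq> {}"
    using assms(2) by (auto simp: connected_def strongly_connected_def)
  ultimately have "Max ?d \<in> ?d" by (intro Max_in) auto
  then have "D \<in> ?d"
    using assms(4) by (simp only: graph_diameter_def)
  then obtain u v where uv: "u \<in> verts G" "v \<in> verts G" "graph_dist G u v = D"
    by blast
  obtain f where f: "\<And>i. i \<le> D \<Longrightarrow> u \<rightarrow>\<^sup>*\<^bsub>G\<^esub> f i \<and> graph_dist G u (f i) = i"
    and step: "\<And>i. i < D \<Longrightarrow> f i \<rightarrow>\<^bsub>G\<^esub> f (Suc i)"
    using geodesic[OF reach[OF uv(1,2)]] unfolding uv(3) by metis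
  have reach_f: "u \<rightarrow>\<^sup>*\<^bsub>G\<^esub> f i" and dist_f: "graph_dist G u (f i) = i" if "i \<le> D" for i
    using f[OF that] by simp_all
  have inj: "inj_on f {..D}"
    by (rule inj_on_inverseI[of _ "graph_dist G u"]) (simp add: dist_f)
  have f_verts: "f ` {..D} \<subseteq> verts G"
    using reach_f by (auto dest: reachable_in_verts)
  \<comment> \<open>The path is induced: an edge changes the distance from \<open>u\<close> by at
    most 1, in either direction.\<close>
  have adj_f: "f i \<rightarrow>\<^bsub>G\<^esub> f j \<longleftrightarrow> Suc i = j \<or> i = Suc j" if "i \<le> D" "j \<le> D" for i j
  proof
    assume ij: "f i \<rightarrow>\<^bsub>G\<^esub> f j"
    have "j \<le> Suc i"
      using graph_dist_arc_le[OF reach_f[OF that(1)] ij] by (simp add: dist_f that)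
    moreover have "i \<le> Suc j"
      using graph_dist_arc_le[OF reach_f[OF that(2)] adj_sym[OF ij]] by (simp add: dist_f that)
    moreover have "i \<noteq> j" using adj_not_same ij by blast
    ultimately show "Suc i = j \<or> i = Suc j" by linarith
  next
    assume "Suc i = j \<or> i = Suc j"
    then show "f i \<rightarrow>\<^bsub>G\<^esub> f j" using step that by (auto intro: adj_sym)
  qed
  \<comment> \<open>A path of length \<open>D\<close> has \<open>Suc D\<close> vertices, which turns
    \<open>2 * m + 2\<close> into \<open>2 * D + 4\<close>.\<close>
  define S where "S = path_resolving (Suc D)"
  have S_le: "S \<subseteq> {..D}" by (auto simp: S_def path_resolving_def)
  define W where "W = (verts G - f ` {..D}) \<union> f ` S"
  have "adj_resolving G W"
    unfolding adj_resolving_def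
  proof (intro conjI inj_onI)
    show "W \<subseteq> verts G" using f_verts S_le by (auto simp: W_def)
  next
    fix x y
    assume xy: "x \<in> verts G" "y \<in> verts G" and eq: "adj_rep G W x = adj_rep G W y"
    show "x = y"
    \<comment> \<open>A vertex of \<open>W\<close> is the only one with coordinate 0 at itself; two
      vertices outside \<open>W\<close> both lie on the path.\<close>
    proof (cases "x \<in> W \<or> y \<in> W")
      case True
      then show ?thesis
        using adj_rep_eqD[OF eq] by (metis adj_dist_eq_0_iff)
    next
      case False
      then obtain i j where ij: "x = f i" "y = f j" "i \<le> D" "j \<le> D" "i \<notin> S" "j \<notin> S"
        using xy by (auto simp: W_def)
      have same: "(Suc i = k \<or> i = Suc k) = (Suc j = k \<or> j = Suc k)" if "k \<in> S" for k
      proof -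
        have "k \<le> D" using that S_le by auto
        \<comment> \<open>With coordinate 0 excluded, equal coordinates at \<open>f k\<close> mean
          equal adjacency to \<open>f k\<close>.\<close>
        moreover have "f i \<noteq> f k" "f j \<noteq> f k" using False that ij(1,2) by (auto simp: W_def)
        moreover have "adj_dist G (f i) (f k) = adj_dist G (f j) (f k)"
          using adj_rep_eqD[OF eq, of "f k"] that ij(1,2) by (simp add: W_def)
        ultimately show ?thesis
          using adj_f ij(3,4) by (auto simp: adj_dist_def split: if_splits)
      qed
      have "\<not> i < j" "\<not> j < i"
        by (rule notI, erule path_resolving_separates[where m = "Suc D"];
            use ij(3-6) same in \<open>auto simp: S_def\<close>)+
      then show ?thesis using ij(1,2) by simp
    qed
  qed
  then have "adj_dim G \<le> card W" by (rule adj_dim_le)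
  also have "\<dots> \<le> card (verts G - f ` {..D}) + card (f ` S)"
    unfolding W_def by (rule card_Un_le)
  also have "card (f ` S) = (2 * D + 4) div 5"
    using inj_on_subset[OF inj S_le] card_path_resolving[of "Suc D"]
    by (simp add: card_image S_def)
  also have "card (verts G - f ` {..D}) = n - Suc D"
    using f_verts inj assms(3) by (simp add: card_Diff_subset card_image)
  finally have "adj_dim G \<le> n - Suc D + (2 * D + 4) div 5" .
  \<comment> \<open>Ensures that the natural subtraction \<open>n - Suc D\<close> agrees with the
    integer one.\<close>
  moreover have "Suc D \<le> n"
    using card_mono[OF finite_verts f_verts] inj assms(3) by (simp add: card_image)
  moreover have "\<lfloor>(2 * real D + 4) / 5\<rfloor> = int ((2 * D + 4) div 5)"
    using floor_divide_of_nat_eq[of "2 * D + 4" 5, where 'a = real] by simp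
  ultimately show ?thesis by linarith
qed

end
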